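(* Let $f,g:\mathbb{R}\to\mathbb{R}$ be smooth functions with $f$ even and $g$ odd. The Liénard system $$\dot x = y,\qquad \dot y = -g(x)-f(x)\,y$$ is a contact Hamiltonian system, in the following sense. On $\mathbb{R}^3$ with coordinates $(q,p,s)$ and contact form $\eta = ds - p\,dq$, consider the contact Hamiltonian $$\mathcal{H}(q,p,s) = p s + f(q) s + g(q).$$ The associated contact Hamiltonian system (the flow equations of the contact Hamiltonian vector field $X_{\mathcal{H}}$) is $$\dot q = s,\qquad \dot s = -f(q)s - g(q),\qquad \dot p = -p^2 - f(q)p - f'(q)s - g'(q).$$ The equations for $q$ and $s$ do not involve $p$ (so the equation for $p$ is decoupled), and under the identification $(q,s)=(x,y)$ they are exactly the original Liénard system.
   Context: For a smooth function $\mathcal{H}$ on $\mathbb{R}^3$ with contact form $\eta = ds-p\,dq$ and Reeb vector field $\mathcal{R}=\partial/\partial s$, the contact Hamiltonian vector field $X_{\mathcal{H}}$ is the unique vector field satisfying $\iota_{X_{\mathcal{H}}}\eta = -\mathcal{H}$ and $\iota_{X_{\mathcal{H}}}d\eta = d\mathcal{H} - (\mathcal{R}\mathcal{H})\,\eta$. In these coordinates, $$X_{\mathcal{H}} = \frac{\partial \mathcal{H}}{\partial p}\frac{\partial}{\partial q} + \Big(-p\frac{\partial \mathcal{H}}{\partial s}-\frac{\partial \mathcal{H}}{\partial q}\Big)\frac{\partial}{\partial p} + \Big(p\frac{\partial \mathcal{H}}{\partial p}-\mathcal{H}\Big)\frac{\partial}{\partial s}.$$ *)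

theory Defs
  imports "HOL-Analysis.Analysis"
begin

text \<open>
  \<open>C_k k f\<close>: the function \<open>f\<close> is \<open>k\<close> times continuously differentiable on the whole space.
  The recursion goes through all directional derivatives, which on a finite-dimensional domain
  amounts to the usual notion. The differential of \<open>H\<close> at \<open>z\<close> is
  \<^term>\<open>frechet_derivative H (at z)\<close>.
\<close>

primrec C_k :: "nat \<Rightarrow> ('a::euclidean_space \<Rightarrow> 'b::real_normed_vector) \<Rightarrow> bool" where
  "C_k 0 f \<longleftrightarrow> continuous_on UNIV f"
| "C_k (Suc k) f \<longleftrightarrow>
     (\<forall>x. f differentiable (at x)) \<and> (\<forall>v. C_k k (\<lambda>x. frechet_derivative f (at x) v))"

definition smooth :: "('a::euclidean_space \<Rightarrow> 'b::real_normed_vector) \<Rightarrow> bool" where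
  "smooth f \<longleftrightarrow> (\<forall>k. C_k k f)"

text \<open>
  A 1-form is a map \<open>\<alpha>\<close> with \<open>\<alpha> z v\<close> its value at the point \<open>z\<close> on the tangent vector \<open>v\<close>;
  2-forms take two tangent vectors. Vectors \<open>u\<close>, \<open>v\<close> below are constant vector fields, so the
  bracket term of the invariant formula for the exterior derivative vanishes. The normalization
  is the one without the factor 1/2.
\<close>

definition ext_deriv :: "('a::euclidean_space \<Rightarrow> 'a \<Rightarrow> real) \<Rightarrow> 'a \<Rightarrow> 'a \<Rightarrow> 'a \<Rightarrow> real" where
  "ext_deriv \<alpha> z u v =
     frechet_derivative (\<lambda>x. \<alpha> x v) (at z) u - frechet_derivative (\<lambda>x. \<alpha> x u) (at z) v"

definition is_reeb_field ::
    "('a::euclidean_space \<Rightarrow> 'a \<Rightarrow> real) \<Rightarrow> ('a \<Rightarrow> 'a) \<Rightarrow> bool" where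
  "is_reeb_field \<alpha> R \<longleftrightarrow> smooth R \<and> (\<forall>z. \<alpha> z (R z) = 1 \<and> (\<forall>v. ext_deriv \<alpha> z (R z) v = 0))"

definition is_contact_hamiltonian_field ::
    "('a::euclidean_space \<Rightarrow> 'a \<Rightarrow> real) \<Rightarrow> ('a \<Rightarrow> 'a) \<Rightarrow> ('a \<Rightarrow> real) \<Rightarrow> ('a \<Rightarrow> 'a) \<Rightarrow> bool" where
  "is_contact_hamiltonian_field \<alpha> R H X \<longleftrightarrow> smooth X \<and>
     (\<forall>z. \<alpha> z (X z) = - H z \<and>
       (\<forall>v. ext_deriv \<alpha> z (X z) v =
              frechet_derivative H (at z) v - frechet_derivative H (at z) (R z) * \<alpha> z v))"

text \<open>
  Points of \<open>\<real>\<^sup>3\<close> are triples \<open>(q, p, s)\<close>, in this order; tangent vectors are triples of the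
  coefficients of \<open>\<partial>/\<partial>q\<close>, \<open>\<partial>/\<partial>p\<close>, \<open>\<partial>/\<partial>s\<close>.
\<close>

type_synonym R3 = "real \<times> real \<times> real"

definition eta :: "R3 \<Rightarrow> R3 \<Rightarrow> real" where
  "eta = (\<lambda>(q, p, s) (dq, dp, ds). ds - p * dq)"

definition d_ds :: "R3 \<Rightarrow> R3" where
  "d_ds = (\<lambda>z. (0, 0, 1))"

definition contact_hamiltonian_field :: "(R3 \<Rightarrow> real) \<Rightarrow> R3 \<Rightarrow> R3" where
  "contact_hamiltonian_field H = (THE X. is_contact_hamiltonian_field eta d_ds H X)"

text \<open>At an endpoint of \<open>T\<close> contained in \<open>T\<close> the derivative is one-sided.\<close>

definition solves_on ::
    "real set \<Rightarrow> ('a::real_normed_vector \<Rightarrow> 'a) \<Rightarrow> (real \<Rightarrow> 'a) \<Rightarrow> bool" where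
  "solves_on T X \<gamma> \<longleftrightarrow> (\<forall>t\<in>T. (\<gamma> has_vector_derivative X (\<gamma> t)) (at t within T))"

definition lienard_field :: "(real \<Rightarrow> real) \<Rightarrow> (real \<Rightarrow> real) \<Rightarrow> real \<times> real \<Rightarrow> real \<times> real" where
  "lienard_field f g = (\<lambda>(x, y). (y, - g x - f x * y))"

definition lienard_hamiltonian :: "(real \<Rightarrow> real) \<Rightarrow> (real \<Rightarrow> real) \<Rightarrow> R3 \<Rightarrow> real" where
  "lienard_hamiltonian f g = (\<lambda>(q, p, s). p * s + f q * s + g q)"

definition proj_qs :: "R3 \<Rightarrow> real \<times> real" where
  "proj_qs = (\<lambda>(q, p, s). (q, s))"

lemma eta_apply: "eta (q, p, s) (a, b, c) = c - p * a"
  by (simp add: eta_def)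

lemma ext_deriv_eta: "ext_deriv eta z (a, b, c) (a', b', c') = a * b' - b * a'"
proof -
  have *: "frechet_derivative (\<lambda>x. eta x (a, b, c)) (at z) = (\<lambda>h. - fst (snd h) * a)"
    for a b c :: real
  proof -
    have "((\<lambda>x. eta x (a, b, c)) has_derivative (\<lambda>h. - fst (snd h) * a)) (at z)"
      unfolding eta_def case_prod_beta fst_conv snd_conv
      by (auto intro!: derivative_eq_intros)
    then show ?thesis
      by (rule frechet_derivative_at [symmetric])
  qed
  show ?thesis
    by (simp add: ext_deriv_def * algebra_simps)
qed

lemma eta_wedge_d_eta_nonzero:
  fixes z :: R3
  defines "\<omega> \<equiv> ext_deriv eta z"
    and "e1 \<equiv> (1, 0, 0)" and "e2 \<equiv> (0, 1, 0)" and "e3 \<equiv> (0, 0, 1)"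
  shows "eta z e1 * \<omega> e2 e3 - eta z e2 * \<omega> e1 e3 + eta z e3 * \<omega> e1 e2 = 1"
  by (cases z) (simp add: assms ext_deriv_eta eta_apply)

lemma C_k_const: "C_k k (\<lambda>x. c)"
  by (induction k arbitrary: c) auto

lemma is_reeb_field_d_ds: "is_reeb_field eta d_ds"
  unfolding is_reeb_field_def smooth_def d_ds_def
  by (auto simp: C_k_const ext_deriv_eta eta_apply)

end

theory Submission
  imports Defs
begin

text \<open>
  Since \<open>d\<eta> = dq \<and> dp\<close>, evaluating the second defining equation on \<open>\<partial>/\<partial>q\<close> and \<open>\<partial>/\<partial>p\<close>
  determines the \<open>p\<close>- and \<open>q\<close>-components of the contact Hamiltonian field, and the first
  equation then gives the \<open>s\<close>-component. For \<open>H = p s + f(q) s + g(q)\<close> the terms containing \<open>p\<close>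
  cancel in \<open>p \<partial>H/\<partial>p - H\<close>, so the \<open>(q, s)\<close>-part is the Lienard field.
\<close>

section \<open>Closure properties of \<open>C_k\<close>\<close>

lemma C_k_SucI:
  assumes "\<And>x. (f has_derivative f' x) (at x)" and "\<And>v. C_k k (\<lambda>x. f' x v)"
  shows "C_k (Suc k) f"
proof -
  \<comment> \<open>\<open>frechet_derivative\<close> is a choice operator; uniqueness of
    derivatives identifies it with the explicit \<open>f'\<close>, so any derivative rule can feed
    the inductions below.\<close>
  have "frechet_derivative f (at x) = f' x" for x
    using assms(1) by (metis frechet_derivative_at)
  then show ?thesis
    using assms by (auto simp: differentiable_def)
qed

lemma C_k_Suc_has_derivative:
  "C_k (Suc k) f \<Longrightarrow> (f has_derivative frechet_derivative f (at x)) (at x)"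
  by (simp add: frechet_derivative_works)

text \<open>The recursion strips derivatives from the outside, so the drop in order is passed down
  to the directional derivatives until only "differentiable implies continuous" remains.\<close>

lemma C_k_Suc_imp_C_k: "C_k (Suc k) f \<Longrightarrow> C_k k f"
proof (induction k arbitrary: f)
  case 0
  then show ?case
    by (auto simp: continuous_on_eq_continuous_at differentiable_imp_continuous_within)
next
  case (Suc k)
  then show ?case
    by (metis C_k.simps(2))
qed

lemma C_k_add: "C_k k f \<Longrightarrow> C_k k g \<Longrightarrow> C_k k (\<lambda>x. f x + g x)"
proof (induction k arbitrary: f g)
  case 0
  then show ?case
    by (simp add: continuous_on_add)
next
  case (Suc k)
  show ?case
    by (rule C_k_SucI[OF has_derivative_add[OF C_k_Suc_has_derivative[OF Suc.prems(1)]
            C_k_Suc_has_derivative[OF Suc.prems(2)]]])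
      (use Suc in auto)
qed

text \<open>By the product rule, a directional derivative is a sum of two terms of the same form
  \<open>B _ _\<close>. Each pairs an original function, lowered to order \<open>k\<close>, with a
  derivative that has order \<open>k\<close> already.\<close>

lemma C_k_bilinear:
  assumes "bounded_bilinear B"
  shows "C_k k f \<Longrightarrow> C_k k g \<Longrightarrow> C_k k (\<lambda>x. B (f x) (g x))"
proof (induction k arbitrary: f g)
  case 0
  then show ?case
    by (simp add: bounded_bilinear.continuous_on[OF assms])
next
  case (Suc k)
  show ?case
  proof (rule C_k_SucI[OF bounded_bilinear.FDERIV[OF assms
            C_k_Suc_has_derivative[OF Suc.prems(1)] C_k_Suc_has_derivative[OF Suc.prems(2)]]])
    show "C_k k (\<lambda>x. B (f x) (frechet_derivative g (at x) v)
        + B (frechet_derivative f (at x) v) (g x))" for v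
      using Suc.prems by (intro C_k_add Suc.IH C_k_Suc_imp_C_k[of k f] C_k_Suc_imp_C_k[of k g]) auto
  qed
qed

lemmas C_k_mult = C_k_bilinear[OF bounded_bilinear_mult]

lemma C_k_linear_comp:
  assumes "bounded_linear L"
  shows "C_k k f \<Longrightarrow> C_k k (\<lambda>x. L (f x))"
proof (induction k arbitrary: f)
  case 0
  then show ?case
    by (simp add: bounded_linear.continuous_on[OF assms])
next
  case (Suc k)
  show ?case
    by (rule C_k_SucI[OF bounded_linear.has_derivative[OF assms
            C_k_Suc_has_derivative[OF Suc.prems]]])
      (use Suc in auto)
qed

text \<open>The derivative in direction \<open>v\<close> is the derivative of \<open>f\<close> in
  the constant direction \<open>L v\<close>, again composed with \<open>L\<close>, so the induction
  needs no product rule. Taking \<open>L = fst\<close> makes \<open>f\<close> and \<open>g\<close>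
  into functions on \<open>R3\<close>.\<close>

lemma C_k_comp_linear:
  fixes L :: "'a::euclidean_space \<Rightarrow> 'b::euclidean_space"
  assumes "bounded_linear L"
  shows "C_k k f \<Longrightarrow> C_k k (\<lambda>x. f (L x))"
proof (induction k arbitrary: f)
  case 0
  then show ?case
    by (auto intro: continuous_on_compose2[of UNIV f] linear_continuous_on assms)
next
  case (Suc k)
  show ?case
    by (rule C_k_SucI[OF has_derivative_compose[OF bounded_linear_imp_has_derivative[OF assms]
            C_k_Suc_has_derivative[OF Suc.prems]]])
      (use Suc in auto)
qed

lemma C_k_Pair: "C_k k f \<Longrightarrow> C_k k g \<Longrightarrow> C_k k (\<lambda>x. (f x, g x))"
proof (induction k arbitrary: f g)
  case 0
  then show ?case
    by (simp add: continuous_on_Pair)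
next
  case (Suc k)
  show ?case
    by (rule C_k_SucI[OF has_derivative_Pair[OF C_k_Suc_has_derivative[OF Suc.prems(1)]
            C_k_Suc_has_derivative[OF Suc.prems(2)]]])
      (use Suc in auto)
qed

lemma C_k_id: "C_k k (\<lambda>x. x)"
  by (cases k) (auto intro: C_k_SucI[OF has_derivative_ident] C_k_const)

section \<open>Closure properties of smooth functions\<close>

lemma smooth_id: "smooth (\<lambda>x. x)"
  by (simp add: smooth_def C_k_id)

lemma smooth_add: "smooth f \<Longrightarrow> smooth g \<Longrightarrow> smooth (\<lambda>x. f x + g x)"
  by (auto simp: smooth_def C_k_add)

lemma smooth_Pair: "smooth f \<Longrightarrow> smooth g \<Longrightarrow> smooth (\<lambda>x. (f x, g x))"
  by (auto simp: smooth_def C_k_Pair)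

lemma smooth_mult:
  fixes f g :: "'a::euclidean_space \<Rightarrow> 'b::real_normed_algebra"
  shows "smooth f \<Longrightarrow> smooth g \<Longrightarrow> smooth (\<lambda>x. f x * g x)"
  by (auto simp: smooth_def C_k_mult)

lemma smooth_linear_comp: "bounded_linear L \<Longrightarrow> smooth f \<Longrightarrow> smooth (\<lambda>x. L (f x))"
  by (auto simp: smooth_def C_k_linear_comp)

lemma smooth_comp_linear:
  fixes L :: "'a::euclidean_space \<Rightarrow> 'b::euclidean_space"
  shows "bounded_linear L \<Longrightarrow> smooth f \<Longrightarrow> smooth (\<lambda>x. f (L x))"
  by (auto simp: smooth_def C_k_comp_linear)

lemmas smooth_comp_fst = smooth_comp_linear[OF bounded_linear_fst]
  and smooth_fst = smooth_linear_comp[OF bounded_linear_fst]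
  and smooth_snd = smooth_linear_comp[OF bounded_linear_snd]
  and smooth_uminus = smooth_linear_comp[OF bounded_linear_minus[OF bounded_linear_ident]]

lemma smooth_diff: "smooth f \<Longrightarrow> smooth g \<Longrightarrow> smooth (\<lambda>x. f x - g x)"
  using smooth_add[OF _ smooth_uminus] by simp

lemma smooth_frechet_derivative: "smooth f \<Longrightarrow> smooth (\<lambda>x. frechet_derivative f (at x) v)"
  unfolding smooth_def by (metis C_k.simps(2))

lemma smooth_has_derivative:
  "smooth f \<Longrightarrow> (f has_derivative frechet_derivative f (at x)) (at x)"
  unfolding smooth_def by (metis C_k_Suc_has_derivative)

lemma smooth_has_real_derivative:
  fixes f :: "real \<Rightarrow> real"
  shows "smooth f \<Longrightarrow> (f has_real_derivative deriv f x) (at x)"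
  by (metis DERIV_deriv_iff_real_differentiable differentiable_def smooth_has_derivative)

lemmas smooth_intros = smooth_id smooth_add smooth_diff smooth_mult smooth_Pair
  smooth_fst smooth_snd smooth_uminus smooth_frechet_derivative smooth_comp_fst

section \<open>The contact Hamiltonian field of an arbitrary smooth Hamiltonian\<close>

lemma is_contact_hamiltonian_field_eta_iff:
  fixes H :: "R3 \<Rightarrow> real"
  assumes "smooth H"
  defines "D \<equiv> \<lambda>z. frechet_derivative H (at z)"
  shows "is_contact_hamiltonian_field eta d_ds H X \<longleftrightarrow>
    X = (\<lambda>z. (D z (0, 1, 0),
               - fst (snd z) * D z (0, 0, 1) - D z (1, 0, 0),
               fst (snd z) * D z (0, 1, 0) - H z))" (is "_ \<longleftrightarrow> X = ?X")
proof -
  have fold_D: "frechet_derivative H (at z) = D z" for z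
    by (simp add: D_def)
  \<comment> \<open>By linearity the differential is determined by the three partial
    derivatives.\<close>
  have D: "D z (a, b, c) = a * D z (1, 0, 0) + b * D z (0, 1, 0) + c * D z (0, 0, 1)"
    for z and a b c :: real
  proof -
    have lin: "linear (D z)"
      unfolding D_def using smooth_has_derivative[OF assms(1)] has_derivative_linear by blast
    have "D z (a, b, c) = D z (a *\<^sub>R (1, 0, 0) + b *\<^sub>R (0, 1, 0) + c *\<^sub>R (0, 0, 1))"
      by simp
    then show ?thesis
      by (simp only: linear_add[OF lin] linear_scale[OF lin] real_scaleR_def)
  qed
  have smooth: "smooth ?X"
    unfolding D_def by (intro smooth_intros assms(1))
  \<comment> \<open>Apart from smoothness, the defining conditions are algebraic at each point, so
    they are solved for a single tangent vector \<open>x\<close> at \<open>z\<close>.\<close>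
  have pointwise: "(eta z x = - H z \<and>
      (\<forall>v. ext_deriv eta z x v = D z v - D z (d_ds z) * eta z v)) \<longleftrightarrow> x = ?X z" for z x
  proof -
    obtain q p s where z: "z = (q, p, s)" by (cases z)
    obtain a b c where x: "x = (a, b, c)" by (cases x)
    have eta_z: "eta z (a', b', c') = c' - p * a'" for a' b' c'
      by (simp add: z eta_apply)
    have "(\<forall>v. ext_deriv eta z x v = D z v - D z (d_ds z) * eta z v) \<longleftrightarrow>
        a = D z (0, 1, 0) \<and> b = - p * D z (0, 0, 1) - D z (1, 0, 0)" (is "?all \<longleftrightarrow> ?ab")
    proof
      assume ?all
      \<comment> \<open>Testing on \<open>(0, 0, 1)\<close> would only give 0 = 0: the Reeb
        direction lies in the kernel of the exterior derivative of \<open>eta\<close>, and the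
        right-hand side vanishes there too.\<close>
      from this[rule_format, of "(1, 0, 0)"] this[rule_format, of "(0, 1, 0)"] show ?ab
        by (simp add: x ext_deriv_eta d_ds_def eta_z algebra_simps)
    next
      assume ?ab
      then have "ext_deriv eta z x (a', b', c') =
          D z (a', b', c') - D z (d_ds z) * eta z (a', b', c')" for a' b' c'
        unfolding D[of z a' b' c']
        by (simp add: x ext_deriv_eta d_ds_def eta_z) (simp add: algebra_simps)
      then show ?all by auto
    qed
    then show ?thesis
      by (auto simp: x z eta_apply)
  qed
  show ?thesis
    \<comment> \<open>What remains is \<open>smooth X\<close> together with pointwise equality to
      \<open>?X\<close>; the smoothness of \<open>?X\<close> serves the direction from right to
      left.\<close>
    unfolding is_contact_hamiltonian_field_def fold_D pointwise
    using smooth by (metis (no_types, lifting) ext)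
qed

text \<open>The equivalence above turns the definite description into \<open>THE X. X = ...\<close>,
  which evaluates at once.\<close>

lemma contact_hamiltonian_field_eta:
  fixes H :: "R3 \<Rightarrow> real"
  assumes "smooth H"
  defines "D \<equiv> \<lambda>z. frechet_derivative H (at z)"
  shows "contact_hamiltonian_field H = (\<lambda>z. (D z (0, 1, 0),
               - fst (snd z) * D z (0, 0, 1) - D z (1, 0, 0),
               fst (snd z) * D z (0, 1, 0) - H z))"
  unfolding contact_hamiltonian_field_def is_contact_hamiltonian_field_eta_iff[OF assms(1)] D_def
  by (rule the_eq_trivial)

section \<open>The Lienard Hamiltonian, its differential and its field\<close>

lemma lienard_hamiltonian_alt:
  "lienard_hamiltonian f g =
     (\<lambda>z. fst (snd z) * snd (snd z) + f (fst z) * snd (snd z) + g (fst z))"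
  by (simp add: lienard_hamiltonian_def fun_eq_iff)

lemma smooth_lienard_hamiltonian:
  "smooth f \<Longrightarrow> smooth g \<Longrightarrow> smooth (lienard_hamiltonian f g)"
  \<comment> \<open>Written with projections instead of a pattern match, the Hamiltonian has the
    shape of the closure rules.\<close>
  unfolding lienard_hamiltonian_alt by (intro smooth_intros)

lemma frechet_derivative_lienard_hamiltonian:
  assumes "smooth f" and "smooth g"
  shows "frechet_derivative (lienard_hamiltonian f g) (at (q, p, s)) =
    (\<lambda>(a, b, c). (deriv f q * s + deriv g q) * a + s * b + (p + f q) * c)"
proof -
  \<comment> \<open>Chain rule along the projection to \<open>q\<close>, stated for a generic
    \<open>h\<close> so that it serves both \<open>f\<close> and \<open>g\<close>.\<close>
  have "((\<lambda>z::R3. h (fst z)) has_derivative (\<lambda>v. fst v * deriv h q)) (at (q, p, s))"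
    if "smooth h" for h :: "real \<Rightarrow> real"
  proof -
    have "(h has_derivative (\<lambda>x. x * deriv h q)) (at (fst (q, p, s)))"
      using smooth_has_real_derivative[OF that, of q]
      by (simp add: has_field_derivative_def mult_commute_abs)
    from has_derivative_compose[OF bounded_linear_imp_has_derivative[OF bounded_linear_fst] this]
    show ?thesis .
  qed
  from this[OF assms(1)] this[OF assms(2)]
  have "(lienard_hamiltonian f g has_derivative
    (\<lambda>(a, b, c). (deriv f q * s + deriv g q) * a + s * b + (p + f q) * c)) (at (q, p, s))"
    unfolding lienard_hamiltonian_alt
    by (auto intro!: derivative_eq_intros simp: fun_eq_iff algebra_simps)
  then show ?thesis
    by (rule frechet_derivative_at[symmetric])
qed

lemma contact_hamiltonian_field_lienard:
  assumes "smooth f" and "smooth g"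
  shows "contact_hamiltonian_field (lienard_hamiltonian f g) (q, p, s) =
    (s, - p\<^sup>2 - f q * p - deriv f q * s - deriv g q, - f q * s - g q)"
  unfolding contact_hamiltonian_field_eta[OF smooth_lienard_hamiltonian[OF assms]]
  \<comment> \<open>The Hamiltonian stays folded until its differential has been rewritten. The term
    \<open>- p\<^sup>2\<close> comes from multiplying the \<open>s\<close>-derivative
    \<open>p + f q\<close> by \<open>- p\<close>.\<close>
  by (simp add: frechet_derivative_lienard_hamiltonian[OF assms])
    (simp add: lienard_hamiltonian_def power2_eq_square algebra_simps)

section \<open>Flow equations and projection to the Lienard system\<close>

lemma has_vector_derivative_Pair_iff:
  "((\<lambda>t. (x t, y t)) has_vector_derivative (a, b)) (at t within T) \<longleftrightarrow>
    (x has_vector_derivative a) (at t within T) \<and> (y has_vector_derivative b) (at t within T)"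
proof
  assume *: "((\<lambda>t. (x t, y t)) has_vector_derivative (a, b)) (at t within T)"
  show "(x has_vector_derivative a) (at t within T) \<and> (y has_vector_derivative b) (at t within T)"
    using has_derivative_fst[OF *[unfolded has_vector_derivative_def]]
      has_derivative_snd[OF *[unfolded has_vector_derivative_def]]
    by (simp add: has_vector_derivative_def)
next
  assume "(x has_vector_derivative a) (at t within T) \<and> (y has_vector_derivative b) (at t within T)"
  then show "((\<lambda>t. (x t, y t)) has_vector_derivative (a, b)) (at t within T)"
    using has_derivative_Pair[of x _ t T y] by (simp add: has_vector_derivative_def)
qed

theorem theorem2p2:
  fixes f g :: "real \<Rightarrow> real"
  assumes "smooth f" and "smooth g"
    and "\<And>x. f (- x) = f x" and "\<And>x. g (- x) = - g x"
  shows
    "smooth (lienard_hamiltonian f g) \<and>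
     (\<exists>!X. is_contact_hamiltonian_field eta d_ds (lienard_hamiltonian f g) X) \<and>
     is_contact_hamiltonian_field eta d_ds (lienard_hamiltonian f g)
       (contact_hamiltonian_field (lienard_hamiltonian f g)) \<and>
     (\<forall>q p s. contact_hamiltonian_field (lienard_hamiltonian f g) (q, p, s) =
        (s, - p\<^sup>2 - f q * p - deriv f q * s - deriv g q, - f q * s - g q)) \<and>
     (\<forall>T q p s.
        solves_on T (contact_hamiltonian_field (lienard_hamiltonian f g)) (\<lambda>t. (q t, p t, s t)) \<longleftrightarrow>
        (\<forall>t\<in>T.
           (q has_real_derivative s t) (at t within T) \<and>
           (s has_real_derivative - f (q t) * s t - g (q t)) (at t within T) \<and>
           (p has_real_derivative
              - (p t)\<^sup>2 - f (q t) * p t - deriv f (q t) * s t - deriv g (q t)) (at t within T))) \<and>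
     (\<forall>q s p p'. proj_qs (contact_hamiltonian_field (lienard_hamiltonian f g) (q, p, s)) =
                 proj_qs (contact_hamiltonian_field (lienard_hamiltonian f g) (q, p', s))) \<and>
     (\<forall>z. proj_qs (contact_hamiltonian_field (lienard_hamiltonian f g) z) =
          lienard_field f g (proj_qs z)) \<and>
     (\<forall>T q p s.
        solves_on T (contact_hamiltonian_field (lienard_hamiltonian f g)) (\<lambda>t. (q t, p t, s t)) \<longleftrightarrow>
        solves_on T (lienard_field f g) (\<lambda>t. (q t, s t)) \<and>
        (\<forall>t\<in>T. (p has_real_derivative
              - (p t)\<^sup>2 - f (q t) * p t - deriv f (q t) * s t - deriv g (q t)) (at t within T)))"
proof -
  let ?H = "lienard_hamiltonian f g"
  let ?X = "contact_hamiltonian_field ?H"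
  note H = smooth_lienard_hamiltonian[OF assms(1,2)]
  note X = contact_hamiltonian_field_lienard[OF assms(1,2)]
  have unique: "\<exists>!X. is_contact_hamiltonian_field eta d_ds ?H X"
    unfolding is_contact_hamiltonian_field_eta_iff[OF H] by simp
  have field: "is_contact_hamiltonian_field eta d_ds ?H ?X"
    unfolding contact_hamiltonian_field_def by (rule theI'[OF unique])
  \<comment> \<open>The projection intertwines the two fields; independence of \<open>p\<close>
    follows, since \<open>proj_qs\<close> forgets \<open>p\<close>.\<close>
  have proj: "proj_qs (?X z) = lienard_field f g (proj_qs z)" for z
    by (cases z) (simp add: X proj_qs_def lienard_field_def)
  have proj_indep: "proj_qs (?X (q, p, s)) = proj_qs (?X (q, p', s))" for q s p p'
    unfolding proj by (simp add: proj_qs_def)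
  have flow: "solves_on T ?X (\<lambda>t. (q t, p t, s t)) \<longleftrightarrow>
      (\<forall>t\<in>T.
         (q has_real_derivative s t) (at t within T) \<and>
         (s has_real_derivative - f (q t) * s t - g (q t)) (at t within T) \<and>
         (p has_real_derivative
            - (p t)\<^sup>2 - f (q t) * p t - deriv f (q t) * s t - deriv g (q t)) (at t within T))"
    for T q p s
    \<comment> \<open>A triple is a nested pair, so splitting pairs twice yields three scalar
      equations, over any set \<open>T\<close>.\<close>
    by (auto simp: solves_on_def X has_vector_derivative_Pair_iff
        has_real_derivative_iff_has_vector_derivative)
  have lienard: "solves_on T (lienard_field f g) (\<lambda>t. (q t, s t)) \<longleftrightarrow>
      (\<forall>t\<in>T.
         (q has_real_derivative s t) (at t within T) \<and>
         (s has_real_derivative - f (q t) * s t - g (q t)) (at t within T))" for T q s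
  proof -
    \<comment> \<open>The summands are reordered to match the \<open>s\<close>-equation of the
      contact flow syntactically.\<close>
    have "lienard_field f g (x, y) = (y, - f x * y - g x)" for x y
      by (simp add: lienard_field_def)
    then show ?thesis
      by (simp add: solves_on_def has_vector_derivative_Pair_iff
          has_real_derivative_iff_has_vector_derivative)
  qed
  show ?thesis
    \<comment> \<open>After rewriting, the flow equivalence is reflexive, and the last one only
      distributes the bounded quantifier over the conjunction, separating the
      \<open>p\<close>-equation from the other two.\<close>
    unfolding flow lienard
    by (intro conjI allI H unique field X proj proj_indep refl) blast
qed

end
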